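(* Let $0<\lambda\le 1$ and let $f\in\mathcal{G}(\lambda)$. Then the logarithmic coefficients of $f$ satisfy $$|\gamma_n(f)|\le \frac{\lambda}{2n(n+1)}\qquad (n=1,2,3,\ldots),$$ and the inequality is sharp.
   Context: $\mathbb{D}=\{z\in\mathbb{C}:|z|<1\}$. $\mathcal{A}$ is the class of holomorphic functions in $\mathbb{D}$ of the form $f(z)=z+\sum_{n\ge 2}a_nz^n$. For $0<\lambda\le 1$, $\mathcal{G}(\lambda)$ is the class of locally univalent functions $f\in\mathcal{A}$ (i.e. $f'\neq 0$ in $\mathbb{D}$) such that $\Re\left(1+zf''(z)/f'(z)\right)<1+\lambda/2$ for all $z\in\mathbb{D}$; such functions are known to be univalent in $\mathbb{D}$. For a univalent $f\in\mathcal{A}$ the logarithmic coefficients $\gamma_n(f)$ are defined by $\log\frac{f(z)}{z}=\sum_{n=1}^{\infty}2\gamma_n(f)z^n$, $z\in\mathbb{D}$, with the branch of the logarithm vanishing at $z=0$. "Sharp" means that, for given $\lambda$ and $n$, the bound cannot be replaced by a smaller one for the class considered. *)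

theory Defs
  imports "HOL-Complex_Analysis.Complex_Analysis"
begin

abbreviation unit_disc :: "complex set" where
  "unit_disc \<equiv> ball 0 1"

definition class_A :: "(complex \<Rightarrow> complex) set" where
  "class_A = {f. f holomorphic_on unit_disc \<and>
     (\<exists>a. \<forall>z\<in>unit_disc. (\<lambda>n. a (n + 2) * z ^ (n + 2)) sums (f z - z))}"

definition class_G :: "real \<Rightarrow> (complex \<Rightarrow> complex) set" where
  "class_G lam = {f \<in> class_A.
     (\<forall>z\<in>unit_disc. deriv f z \<noteq> 0) \<and>
     (\<forall>z\<in>unit_disc. Re (1 + z * deriv (deriv f) z / deriv f z) < 1 + lam / 2)}"

text \<open>
  The holomorphic branch of log (f(z)/z) on the unit disc that vanishes at 0.  The quotient
  f(z)/z is understood by its removable singularity at 0, where it has the value 1 for f in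
  the class A; as \<open>f 0 / 0 = 0\<close> in HOL, the point 0 is left out of the exponential equation.
\<close>

definition is_log_branch :: "(complex \<Rightarrow> complex) \<Rightarrow> (complex \<Rightarrow> complex) \<Rightarrow> bool" where
  "is_log_branch f L \<longleftrightarrow> L holomorphic_on unit_disc \<and> L 0 = 0 \<and>
     (\<forall>z\<in>unit_disc - {0}. exp (L z) = f z / z)"

text \<open>
  Logarithmic coefficients are indexed from 1; the entry at index 0 is fixed to be 0 so that
  the sequence is unique.  It exists whenever f is a univalent member of the class A.
\<close>

definition log_coeff :: "(complex \<Rightarrow> complex) \<Rightarrow> nat \<Rightarrow> complex" where
  "log_coeff f = (THE \<gamma>. \<gamma> 0 = 0 \<and>
     (\<exists>L. is_log_branch f L \<and>
       (\<forall>z\<in>unit_disc. (\<lambda>n. 2 * \<gamma> (Suc n) * z ^ Suc n) sums L z)))"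

end

theory Submission
  imports Defs
begin

text \<open>
Write \<open>log (f z / z) = L z\<close> and \<open>g z = z * L' z\<close>, so that the Taylor coefficients of \<open>g\<close> are
\<open>b\<^sub>n = 2 n \<gamma>\<^sub>n\<close>; the claim becomes \<open>(n + 1) |b\<^sub>n| \<le> \<lambda>\<close>.  Differentiating \<open>f = z exp L\<close> twice gives the
Riccati equation \<open>g + g\<^sup>2 + z g' = w (1 + g)\<close> with \<open>w = z f'' / f'\<close>.  Let \<open>H\<close> be its left side.  The
defining inequality of the class says \<open>Re w < \<lambda> / 2\<close>, that is \<open>|w| < |w - \<lambda>|\<close>, and hence
\<open>|H| < |H - \<lambda> (1 + g)|\<close> pointwise in the disc.

Clunie's method (\<open>clunie\<close>) turns such a pointwise inequality \<open>|P| < |Q|\<close> with \<open>P 0 = 0\<close> into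
\<open>|P\<^sub>0|\<^sup>2 + \<dots> + |P\<^sub>n|\<^sup>2 \<le> |Q\<^sub>0|\<^sup>2 + \<dots> + |Q\<^bsub>n-1\<^esub>|\<^sup>2\<close>.  Applied to \<open>H\<close>, where
\<open>H\<^sub>k = (k + 1) b\<^sub>k + (g\<^sup>2)\<^sub>k\<close>, it yields \<open>|H\<^sub>n|\<^sup>2 \<le> \<lambda>\<^sup>2 - 2 \<lambda> S\<close>, where \<open>S\<close> is the sum of
\<open>(k + 1/2) |b\<^sub>k|\<^sup>2\<close> over \<open>k < n\<close> minus a term cubic in the moduli \<open>|b\<^sub>k|\<close>.  The unwanted part \<open>(g\<^sup>2)\<^sub>n\<close> of \<open>H\<^sub>n\<close> is at most
\<open>D\<close>, the sum of \<open>|b\<^sub>k|\<^sup>2\<close> over \<open>k < n\<close>.  By induction the earlier \<open>|b\<^sub>k|\<close> are at most 1/2; this bounds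
the cubic term by the sum of \<open>(k - 1/2) |b\<^sub>k|\<^sup>2\<close>, so \<open>S \<ge> D\<close>, \<open>|H\<^sub>n| \<le> \<lambda> - D\<close>, and the two errors cancel
(\<open>clunie_quadratic_coeff_bound\<close>).

For \<open>L\<close> to exist, \<open>f\<close> must not vanish off the origin.  Clunie's method applied to \<open>z f''\<close> and
\<open>z f'' - \<lambda> f'\<close> gives \<open>|a\<^bsub>k+1\<^esub>| \<le> \<lambda> / (k (k + 1))\<close>, and these bounds telescope to \<open>|f z - z| < |z|\<close>
(\<open>class_G_nonzero\<close>).

Equality for index \<open>n\<close> holds for the function with \<open>f' = (1 - z\<^sup>n)\<close> to the power \<open>\<lambda> / n\<close>.  There
\<open>w = - \<lambda> z\<^sup>n / (1 - z\<^sup>n)\<close>, so the Riccati equation forces \<open>b\<^sub>k = 0\<close> for \<open>k < n\<close> and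
\<open>(n + 1) b\<^sub>n = - \<lambda>\<close> (\<open>extremal_log_coeff\<close>).
\<close>

section \<open>Mean squares over roots of unity\<close>

lemma roots_of_unity_orthogonal:
  fixes N k l :: nat
  defines "\<zeta> \<equiv> cis (2 * pi / real N)"
  assumes "k < N" "l < N"
  shows "(\<Sum>j<N. (\<zeta> ^ j) ^ k * cnj ((\<zeta> ^ j) ^ l)) = (if k = l then of_nat N else 0)"
proof -
  have N: "N > 0" using assms by simp
  have pow: "\<zeta> ^ i = cis (2 * pi * real i / real N)" for i
    unfolding \<zeta>_def Complex.DeMoivre by (rule arg_cong [where f = cis]) simp
  have unit: "\<zeta> ^ i * cnj (\<zeta> ^ i) = 1" for i
    by (simp add: pow cis_cnj cis_mult)
  define x where "x = \<zeta> ^ k * cnj (\<zeta> ^ l)"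
  have summand: "(\<zeta> ^ j) ^ k * cnj ((\<zeta> ^ j) ^ l) = x ^ j" for j
    unfolding x_def by (simp add: power_mult_distrib power_mult [symmetric] mult.commute)
  have "\<zeta> ^ N = 1" using N by (simp add: pow)
  hence xN: "x ^ N = 1"
    unfolding x_def power_mult_distrib complex_cnj_power
    by (metis complex_cnj_one complex_cnj_power mult_1 power_commutes power_mult power_one mult.commute)
  show ?thesis
  proof (cases "k = l")
    case True
    hence "x = 1" using unit by (simp only: x_def)
    thus ?thesis unfolding summand if_P [OF True] by simp
  next
    case False
    have "x \<noteq> 1"
    proof
      assume "x = 1"
      hence "\<zeta> ^ k = \<zeta> ^ l"
        using unit[of l] unfolding x_def by (metis mult.commute mult.left_commute mult_1)
      moreover have "inj_on (\<lambda>i. cis (2 * pi * real i / real N)) {..<N}"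
        using Complex.bij_betw_roots_unity[OF N] by (rule bij_betw_imp_inj_on)
      ultimately show False using False \<open>k < N\<close> \<open>l < N\<close> by (auto simp: pow dest: inj_onD)
    qed
    hence "(\<Sum>j<N. x ^ j) = 0" using xN by (simp add: geometric_sum)
    thus ?thesis unfolding summand if_not_P [OF False] .
  qed
qed

text \<open>
The discrete form of Parseval's identity: a polynomial of degree below \<open>N\<close> is determined by its values
at the \<open>N\<close>-th roots of unity, so finite averages can replace integrals over the circle.
\<close>

lemma parseval_roots_of_unity:
  fixes c :: "nat \<Rightarrow> complex" and N :: nat
  defines "\<zeta> \<equiv> cis (2 * pi / real N)"
  shows "(\<Sum>j<N. (norm (\<Sum>k<N. c k * (\<zeta> ^ j) ^ k))\<^sup>2) = real N * (\<Sum>k<N. (norm (c k))\<^sup>2)"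
proof -
  have "of_real (\<Sum>j<N. (norm (\<Sum>k<N. c k * (\<zeta> ^ j) ^ k))\<^sup>2)
      = (\<Sum>j<N. \<Sum>k<N. \<Sum>l<N. (c k * cnj (c l)) * ((\<zeta> ^ j) ^ k * cnj ((\<zeta> ^ j) ^ l)))"
    unfolding of_real_sum complex_norm_square cnj_sum sum_product
    by (simp add: mult_ac)
  also have "\<dots> = (\<Sum>k<N. \<Sum>l<N. \<Sum>j<N. (c k * cnj (c l)) * ((\<zeta> ^ j) ^ k * cnj ((\<zeta> ^ j) ^ l)))"
    by (subst sum.swap, rule sum.cong [OF refl], rule sum.swap)
  also have "\<dots> = (\<Sum>k<N. \<Sum>l<N. (c k * cnj (c l)) * (if k = l then of_nat N else 0))"
    unfolding sum_distrib_left [symmetric] \<zeta>_def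
    by (intro sum.cong refl arg_cong2[where f = "(*)"] roots_of_unity_orthogonal) auto
  also have "\<dots> = (\<Sum>k<N. (c k * cnj (c k)) * of_nat N)"
    by (simp add: if_distrib cong: if_cong)
  also have "\<dots> = of_real (real N * (\<Sum>k<N. (norm (c k))\<^sup>2))"
    unfolding complex_norm_square [symmetric] by (simp add: sum_distrib_left mult.commute)
  finally show ?thesis unfolding of_real_eq_iff .
qed

text \<open>
Average the pointwise inequality over the \<open>N\<close>-th roots of unity, with \<open>N\<close> above both degrees.
The error \<open>e\<close> leaves room for replacing a power series by its partial sums.
\<close>

lemma polynomial_coeff_squares_le:
  fixes a b :: "nat \<Rightarrow> complex"
  assumes le: "\<And>z. norm z = 1 \<Longrightarrow>
      (norm (\<Sum>k<m. a k * z ^ k))\<^sup>2 \<le> (norm (\<Sum>k<n. b k * z ^ k))\<^sup>2 + e"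
  shows "(\<Sum>k<m. (norm (a k))\<^sup>2) \<le> (\<Sum>k<n. (norm (b k))\<^sup>2) + e"
proof -
  define N where "N = Suc (max m n)"
  define \<zeta> where "\<zeta> = cis (2 * pi / real N)"
  define trunc where "trunc c i k = (if k < i then c k else 0)" for c :: "nat \<Rightarrow> complex" and i k :: nat
  have poly: "(\<Sum>k<N. trunc c i k * z ^ k) = (\<Sum>k<i. c k * z ^ k)" if "i \<le> N" for c i z
    using that unfolding trunc_def by (intro sum.mono_neutral_cong_right) auto
  have sq: "(\<Sum>k<N. (norm (trunc c i k))\<^sup>2) = (\<Sum>k<i. (norm (c k))\<^sup>2)" if "i \<le> N" for c i
    using that unfolding trunc_def by (intro sum.mono_neutral_cong_right) auto
  have mn: "m \<le> N" "n \<le> N" by (auto simp: N_def)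
  have "real N * (\<Sum>k<m. (norm (a k))\<^sup>2) = (\<Sum>j<N. (norm (\<Sum>k<m. a k * (\<zeta> ^ j) ^ k))\<^sup>2)"
    using parseval_roots_of_unity[of "trunc a m" N] mn by (simp add: poly sq \<zeta>_def)
  also have "\<dots> \<le> (\<Sum>j<N. (norm (\<Sum>k<n. b k * (\<zeta> ^ j) ^ k))\<^sup>2 + e)"
    by (intro sum_mono le) (simp add: \<zeta>_def norm_power)
  also have "\<dots> = real N * ((\<Sum>k<n. (norm (b k))\<^sup>2) + e)"
    using parseval_roots_of_unity[of "trunc b n" N] mn
    by (simp add: poly sq \<zeta>_def sum.distrib distrib_left)
  finally show ?thesis by (simp add: N_def)
qed

text \<open>
The partial sums of the series converge uniformly on the circle, so they satisfy the pointwise inequality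
up to an error that tends to 0.
\<close>

lemma series_coeff_squares_le:
  fixes a b :: "nat \<Rightarrow> complex"
  assumes summable: "summable (\<lambda>k. norm (a k))"
    and le: "\<And>z. norm z = 1 \<Longrightarrow> norm (\<Sum>k. a k * z ^ k) \<le> norm (\<Sum>k<n. b k * z ^ k)"
  shows "(\<Sum>k<m. (norm (a k))\<^sup>2) \<le> (\<Sum>k<n. (norm (b k))\<^sup>2)"
proof -
  define \<epsilon> where "\<epsilon> M = (\<Sum>k. norm (a (k + M)))" for M
  define B where "B = (\<Sum>k<n. norm (b k))"
  have \<epsilon>0: "\<epsilon> M \<ge> 0" for M
    unfolding \<epsilon>_def by (intro suminf_nonneg summable_ignore_initial_segment summable) auto
  have \<epsilon>: "\<epsilon> \<longlonglongrightarrow> 0"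
  proof -
    have "\<epsilon> = (\<lambda>M. suminf (\<lambda>k. norm (a k)) - (\<Sum>k<M. norm (a k)))"
      unfolding \<epsilon>_def by (rule ext, subst suminf_minus_initial_segment[OF summable]) simp
    moreover have "\<dots> \<longlonglongrightarrow> suminf (\<lambda>k. norm (a k)) - suminf (\<lambda>k. norm (a k))"
      by (intro tendsto_intros summable_LIMSEQ summable)
    ultimately show ?thesis by simp
  qed
  have bound: "(\<Sum>k<m. (norm (a k))\<^sup>2) \<le> (\<Sum>k<n. (norm (b k))\<^sup>2) + (2 * B * \<epsilon> M + (\<epsilon> M)\<^sup>2)"
    if "M \<ge> m" for M
  proof -
    have "(\<Sum>k<m. (norm (a k))\<^sup>2) \<le> (\<Sum>k<M. (norm (a k))\<^sup>2)"
      using that by (intro sum_mono2) auto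
    also have "\<dots> \<le> (\<Sum>k<n. (norm (b k))\<^sup>2) + (2 * B * \<epsilon> M + (\<epsilon> M)\<^sup>2)"
    proof (rule polynomial_coeff_squares_le)
      fix z :: complex assume z: "norm z = 1"
      define q where "q = (\<Sum>k<n. b k * z ^ k)"
      have nrm: "norm (a k * z ^ k) = norm (a k)" for k using z by (simp add: norm_mult norm_power)
      have sz: "summable (\<lambda>k. norm (a k * z ^ k))" using summable by (simp add: nrm)
      have "(\<Sum>k. a k * z ^ k) = (\<Sum>k. a (k + M) * z ^ (k + M)) + (\<Sum>k<M. a k * z ^ k)"
        by (rule suminf_split_initial_segment) (rule summable_norm_cancel[OF sz])
      moreover have "norm (\<Sum>k. a (k + M) * z ^ (k + M)) \<le> \<epsilon> M"
      proof -
        have "summable (\<lambda>k. norm (a (k + M) * z ^ (k + M)))"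
          using sz by (rule summable_ignore_initial_segment)
        from summable_norm[OF this] show ?thesis by (simp add: nrm \<epsilon>_def)
      qed
      moreover have "norm (\<Sum>k. a k * z ^ k) \<le> norm q" using le[OF z] by (simp add: q_def)
      ultimately have 1: "norm (\<Sum>k<M. a k * z ^ k) \<le> norm q + \<epsilon> M"
        by (smt (verit, best) add_diff_cancel_left' norm_triangle_ineq4)
      have "norm q \<le> B"
        unfolding q_def B_def using z by (intro sum_norm_le) (simp add: norm_mult norm_power)
      hence "2 * norm q * \<epsilon> M \<le> 2 * B * \<epsilon> M" using \<epsilon>0[of M] by (simp add: mult_right_mono)
      moreover have "(norm (\<Sum>k<M. a k * z ^ k))\<^sup>2 \<le> (norm q + \<epsilon> M)\<^sup>2"
        using 1 by (intro power_mono) auto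
      ultimately show "(norm (\<Sum>k<M. a k * z ^ k))\<^sup>2
          \<le> (norm (\<Sum>k<n. b k * z ^ k))\<^sup>2 + (2 * B * \<epsilon> M + (\<epsilon> M)\<^sup>2)"
        unfolding q_def [symmetric] by (simp add: power2_sum)
    qed
    finally show ?thesis .
  qed
  have "(\<lambda>M. (\<Sum>k<n. (norm (b k))\<^sup>2) + (2 * B * \<epsilon> M + (\<epsilon> M)\<^sup>2))
      \<longlonglongrightarrow> (\<Sum>k<n. (norm (b k))\<^sup>2) + (2 * B * 0 + 0\<^sup>2)"
    by (intro tendsto_intros \<epsilon>)
  hence "(\<lambda>M. (\<Sum>k<n. (norm (b k))\<^sup>2) + (2 * B * \<epsilon> M + (\<epsilon> M)\<^sup>2))
      \<longlonglongrightarrow> (\<Sum>k<n. (norm (b k))\<^sup>2)" by simp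
  thus ?thesis using bound by (intro LIMSEQ_le_const) blast+
qed

section \<open>Clunie's method\<close>

lemma holomorphic_unit_disc_series:
  assumes "F has_fps_expansion A" "F holomorphic_on unit_disc" "norm z < 1"
  shows "(\<lambda>k. fps_nth A k * z ^ k) sums F z"
    and "summable (\<lambda>k. norm (fps_nth A k * z ^ k))"
proof -
  have hol: "F holomorphic_on eball 0 (ereal 1)" using assms(2) by simp
  show "(\<lambda>k. fps_nth A k * z ^ k) sums F z"
    by (rule has_fps_expansion_imp_sums_complex[OF assms(1) hol]) (use assms(3) in simp)
  have "ereal 1 \<le> fps_conv_radius A"
    by (rule holomorphic_on_imp_fps_conv_radius_ge[OF assms(1) hol])
  hence "ereal (norm z) < conv_radius (fps_nth A)"
    using assms(3) unfolding fps_conv_radius_def by (metis ereal_less(3) less_ereal.simps(1) order_less_le_trans one_ereal_def)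
  thus "summable (\<lambda>k. norm (fps_nth A k * z ^ k))"
    by (rule abs_summable_in_conv_radius)
qed

text \<open>
The quotient \<open>\<omega> = P / Q\<close> maps the disc into itself and fixes 0.  Because \<open>\<omega> 0 = 0\<close>, the coefficients of
\<open>P = \<omega> Q\<close> up to index \<open>n\<close> depend only on those of \<open>Q\<close> below \<open>n\<close>: they agree with the coefficients of
\<open>\<omega> q\<close>, where \<open>q\<close> is the Taylor polynomial of \<open>Q\<close> of degree below \<open>n\<close>.  Since \<open>|\<omega> q| \<le> |q|\<close>, comparing mean
squares on the circle of radius \<open>r\<close> and letting \<open>r\<close> tend to 1 gives the claim.
\<close>

lemma clunie:
  fixes P Q :: "complex \<Rightarrow> complex"
  assumes hol: "P holomorphic_on unit_disc" "Q holomorphic_on unit_disc"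
    and fps: "P has_fps_expansion A" "Q has_fps_expansion B"
    and zero: "P 0 = 0"
    and less: "\<And>z. z \<in> unit_disc \<Longrightarrow> norm (P z) < norm (Q z)"
  shows "(\<Sum>k\<le>n. (norm (fps_nth A k))\<^sup>2) \<le> (\<Sum>k<n. (norm (fps_nth B k))\<^sup>2)"
proof -
  define \<omega> where "\<omega> z = P z / Q z" for z
  define W where "W = fps_expansion \<omega> 0"
  have Q0: "Q z \<noteq> 0" if "z \<in> unit_disc" for z using less[OF that] by auto
  have hol\<omega>: "\<omega> holomorphic_on unit_disc"
    unfolding \<omega>_def using hol Q0 by (intro holomorphic_intros) auto
  have \<omega>W: "\<omega> has_fps_expansion W"
    unfolding W_def by (rule has_fps_expansion_fps_expansion[OF _ _ hol\<omega>]) auto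
  have \<omega>le: "norm (\<omega> z) \<le> 1" if "z \<in> unit_disc" for z
    using less[OF that] Q0[OF that] by (simp add: \<omega>_def norm_divide)
  have "fps_nth W 0 = 0"
    using has_fps_expansion_imp_0_eq_fps_nth_0[OF \<omega>W] zero by (simp add: \<omega>_def)
  have "P has_fps_expansion W * B"
  proof -
    have "eventually (\<lambda>z. \<omega> z * Q z = P z) (nhds 0)"
      using Q0 by (intro eventually_nhds_in_open[of unit_disc 0, THEN eventually_mono])
                  (auto simp: \<omega>_def)
    moreover have "(\<lambda>z. \<omega> z * Q z) has_fps_expansion W * B"
      by (intro has_fps_expansion_mult \<omega>W fps)
    ultimately show ?thesis by (rule has_fps_expansion_cong[OF _ refl, THEN iffD1])
  qed
  hence A: "A = W * B" using fps(1) fps_expansion_unique_complex by blast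
  define q where "q z = (\<Sum>k<n. fps_nth B k * z ^ k)" for z
  define C where "C = (\<Sum>k<n. fps_const (fps_nth B k) * fps_X ^ k)"
  have C: "fps_nth C k = (if k < n then fps_nth B k else 0)" for k
    unfolding C_def by (simp add: fps_sum_nth if_distrib cong: if_cong)
  have qC: "q has_fps_expansion C"
    unfolding q_def C_def by (intro has_fps_expansion_sum fps_expansion_intros)
  have F: "(\<lambda>z. \<omega> z * q z) has_fps_expansion W * C"
    by (intro has_fps_expansion_mult \<omega>W qC)
  have holF: "(\<lambda>z. \<omega> z * q z) holomorphic_on unit_disc"
    unfolding q_def by (intro holomorphic_intros hol\<omega>)
  have AC: "fps_nth A k = fps_nth (W * C) k" if "k \<le> n" for k
    unfolding A fps_mult_nth
  proof (intro sum.cong refl)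
    fix i assume i: "i \<in> {0..k}"
    show "fps_nth W i * fps_nth B (k - i) = fps_nth W i * fps_nth C (k - i)"
      using i that \<open>fps_nth W 0 = 0\<close> by (cases "i = 0") (auto simp: C)
  qed
  have scaled: "(\<Sum>k<Suc n. (norm (fps_nth A k))\<^sup>2 * (r ^ k)\<^sup>2) \<le> (\<Sum>k<n. (norm (fps_nth B k))\<^sup>2 * (r ^ k)\<^sup>2)"
    if r: "0 < r" "r < 1" for r :: real
  proof -
    have "(\<Sum>k<Suc n. (norm (fps_nth (W * C) k * of_real r ^ k))\<^sup>2)
        \<le> (\<Sum>k<n. (norm (fps_nth B k * of_real r ^ k))\<^sup>2)"
    proof (rule series_coeff_squares_le)
      show "summable (\<lambda>k. norm (fps_nth (W * C) k * of_real r ^ k))"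
        using r by (intro holomorphic_unit_disc_series(2)[OF F holF]) auto
      fix z :: complex assume z: "norm z = 1"
      let ?u = "of_real r * z"
      have u: "norm ?u < 1" using z r by (simp add: norm_mult)
      have "(\<Sum>k. fps_nth (W * C) k * of_real r ^ k * z ^ k) = \<omega> ?u * q ?u"
        using holomorphic_unit_disc_series(1)[OF F holF u]
        by (simp add: sums_iff power_mult_distrib mult_ac)
      moreover have "(\<Sum>k<n. fps_nth B k * of_real r ^ k * z ^ k) = q ?u"
        by (simp add: q_def power_mult_distrib mult_ac)
      moreover have "norm (\<omega> ?u * q ?u) \<le> norm (q ?u)"
        using \<omega>le[of ?u] u by (simp add: norm_mult mult_left_le_one_le)
      ultimately show "norm (\<Sum>k. fps_nth (W * C) k * of_real r ^ k * z ^ k)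
          \<le> norm (\<Sum>k<n. fps_nth B k * of_real r ^ k * z ^ k)" by simp
    qed
    also have "(\<Sum>k<Suc n. (norm (fps_nth (W * C) k * of_real r ^ k))\<^sup>2)
        = (\<Sum>k<Suc n. (norm (fps_nth A k))\<^sup>2 * (r ^ k)\<^sup>2)"
      using r by (intro sum.cong refl) (simp add: AC norm_mult norm_power power_mult_distrib)
    finally show ?thesis using r by (simp add: norm_mult norm_power power_mult_distrib)
  qed
  have "(\<Sum>k<Suc n. (norm (fps_nth A k))\<^sup>2 * (1 ^ k)\<^sup>2) \<le> (\<Sum>k<n. (norm (fps_nth B k))\<^sup>2 * (1 ^ k)\<^sup>2)"
  proof (rule tendsto_le)
    show "eventually (\<lambda>r::real. (\<Sum>k<Suc n. (norm (fps_nth A k))\<^sup>2 * (r ^ k)\<^sup>2)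
        \<le> (\<Sum>k<n. (norm (fps_nth B k))\<^sup>2 * (r ^ k)\<^sup>2)) (at_left 1)"
      using eventually_at_left_real[of 0 1] by (rule eventually_mono) (auto intro: scaled simp del: sum.lessThan_Suc)
    show "((\<lambda>r::real. \<Sum>k<n. (norm (fps_nth B k))\<^sup>2 * (r ^ k)\<^sup>2)
        \<longlongrightarrow> (\<Sum>k<n. (norm (fps_nth B k))\<^sup>2 * (1 ^ k)\<^sup>2)) (at_left 1)"
      by (intro tendsto_intros)
    show "((\<lambda>r::real. \<Sum>k<Suc n. (norm (fps_nth A k))\<^sup>2 * (r ^ k)\<^sup>2)
        \<longlongrightarrow> (\<Sum>k<Suc n. (norm (fps_nth A k))\<^sup>2 * (1 ^ k)\<^sup>2)) (at_left 1)"
      by (intro tendsto_intros)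
  qed simp
  thus ?thesis by (simp add: lessThan_Suc_atMost del: sum.lessThan_Suc)
qed

text \<open>
The half-plane \<open>Re w < \<lambda> / 2\<close> consists of the points closer to 0 than to \<open>\<lambda>\<close>.  This converts the
condition that defines the class into the hypothesis of Clunie's method.
\<close>

lemma norm_half_plane_mult_less:
  fixes w u :: complex and lam :: real
  assumes "0 < lam" "Re w < lam / 2" "u \<noteq> 0"
  shows "norm (w * u) < norm (w * u - of_real lam * u)"
proof -
  have "(norm (w - of_real lam))\<^sup>2 = (norm w)\<^sup>2 + lam * (lam - 2 * Re w)"
    unfolding cmod_power2 by (simp add: power2_eq_square algebra_simps)
  hence "(norm w)\<^sup>2 < (norm (w - of_real lam))\<^sup>2" using assms by simp
  hence "norm w < norm (w - of_real lam)" by (rule power_less_imp_less_base) simp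
  hence "norm w * norm u < norm (w - of_real lam) * norm u" using assms by simp
  thus ?thesis by (simp add: norm_mult [symmetric] left_diff_distrib)
qed

section \<open>Coefficients and zeros of functions in the class\<close>

lemma class_A_fps:
  assumes "f \<in> class_A"
  obtains F where "f has_fps_expansion F" "fps_nth F 0 = 0" "fps_nth F 1 = 1"
    "\<And>z. z \<in> unit_disc \<Longrightarrow> (\<lambda>n. fps_nth F (n + 2) * z ^ (n + 2)) sums (f z - z)"
proof -
  obtain a where a: "\<And>z. z \<in> unit_disc \<Longrightarrow> (\<lambda>n. a (n + 2) * z ^ (n + 2)) sums (f z - z)"
    using assms unfolding class_A_def by blast
  define F where "F = Abs_fps (\<lambda>n. if n = 0 then 0 else if n = 1 then 1 else a n)"
  have tail: "(\<lambda>n. fps_nth F (n + 2) * z ^ (n + 2)) sums (f z - z)" if "z \<in> unit_disc" for z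
    using a[OF that] by (simp add: F_def)
  have "(\<lambda>n. fps_nth F n * z ^ n) sums f z" if "z \<in> unit_disc" for z
  proof -
    have "(\<lambda>n. fps_nth F n * z ^ n) sums (f z - z + (\<Sum>i<2. fps_nth F i * z ^ i))"
      by (rule sums_iff_shift [THEN iffD1, OF tail [OF that]])
    thus ?thesis by (simp add: F_def numeral_2_eq_2)
  qed
  hence "f has_fps_expansion F"
    by (intro has_fps_expansionI eventually_nhds_in_open[of unit_disc 0, THEN eventually_mono]) auto
  thus ?thesis using that tail by (simp add: F_def)
qed

lemma class_G_zero:
  assumes "f \<in> class_G lam"
  shows "f 0 = 0"
proof -
  from assms have "f \<in> class_A" by (simp add: class_G_def)
  thus ?thesis by (metis class_A_fps has_fps_expansion_imp_0_eq_fps_nth_0)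
qed

text \<open>
Clunie's method for \<open>P = z f''\<close> and \<open>Q = z f'' - \<lambda> f'\<close>.  If \<open>d\<^sub>k\<close> are the coefficients of \<open>f'\<close>, then
\<open>P\<^sub>k = k d\<^sub>k\<close> and \<open>Q\<^sub>k = (k - \<lambda>) d\<^sub>k\<close>; for \<open>k \<ge> 1\<close> one has \<open>|Q\<^sub>k| \<le> |P\<^sub>k|\<close>, so everything cancels except
\<open>|P\<^sub>n|\<^sup>2\<close> and \<open>|Q\<^sub>0|\<^sup>2 = \<lambda>\<^sup>2\<close>.
\<close>

lemma class_G_coeff_bound:
  assumes lam: "0 < lam" "lam \<le> 1" and f: "f \<in> class_G lam"
    and F: "f has_fps_expansion F" "fps_nth F 1 = 1" and n: "n \<ge> 1"
  shows "norm (fps_nth F (Suc n)) \<le> lam / (real n * real (Suc n))"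
proof -
  have hol: "f holomorphic_on unit_disc" using f by (simp add: class_G_def class_A_def)
  have hol1: "deriv f holomorphic_on unit_disc" "deriv (deriv f) holomorphic_on unit_disc"
    using hol by (auto intro!: holomorphic_deriv)
  define d where "d = fps_deriv F"
  define A where "A = fps_X * fps_deriv d"
  define B where "B = A - fps_const (of_real lam) * d"
  have A: "fps_nth A k = of_nat k * fps_nth d k" for k
    by (cases k) (simp_all add: A_def)
  have B: "fps_nth B k = of_real (real k - lam) * fps_nth d k" for k
    by (simp add: B_def A algebra_simps)
  have "fps_nth d 0 = 1" using F(2) by (simp add: d_def)
  have "(\<Sum>k\<le>n. (norm (fps_nth A k))\<^sup>2) \<le> (\<Sum>k<n. (norm (fps_nth B k))\<^sup>2)"
  proof (rule clunie)
    show "(\<lambda>z. z * deriv (deriv f) z) has_fps_expansion A"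
      unfolding A_def d_def by (intro fps_expansion_intros F)
    show "(\<lambda>z. z * deriv (deriv f) z - of_real lam * deriv f z) has_fps_expansion B"
      unfolding B_def A_def d_def by (intro fps_expansion_intros F)
    fix z assume z: "z \<in> unit_disc"
    have f': "deriv f z \<noteq> 0" and Re: "Re (z * deriv (deriv f) z / deriv f z) < lam / 2"
      using f z by (auto simp: class_G_def)
    from norm_half_plane_mult_less[OF lam(1) Re f'] f'
    show "norm (z * deriv (deriv f) z) < norm (z * deriv (deriv f) z - of_real lam * deriv f z)"
      by simp
  qed (auto intro!: holomorphic_intros hol1)
  also have "\<dots> \<le> (\<Sum>k<n. (norm (fps_nth A k))\<^sup>2 + (if k = 0 then lam\<^sup>2 else 0))"
  proof (rule sum_mono)
    fix k
    have "(real k - lam)\<^sup>2 \<le> (real k)\<^sup>2" if "k \<noteq> 0"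
      using that lam by (intro power2_le_iff_abs_le[THEN iffD2]) auto
    thus "(norm (fps_nth B k))\<^sup>2 \<le> (norm (fps_nth A k))\<^sup>2 + (if k = 0 then lam\<^sup>2 else 0)"
      by (auto simp: A B norm_mult power_mult_distrib mult_right_mono \<open>fps_nth d 0 = 1\<close> simp del: of_real_diff)
  qed
  also have "\<dots> = (\<Sum>k<n. (norm (fps_nth A k))\<^sup>2) + lam\<^sup>2"
    using n by (simp add: sum.distrib)
  finally have "(norm (fps_nth A n))\<^sup>2 \<le> lam\<^sup>2"
    by (simp add: lessThan_Suc_atMost [symmetric])
  hence "norm (fps_nth A n) \<le> lam" using lam by (simp add: power2_le_iff_abs_le)
  hence "real n * (real (Suc n) * norm (fps_nth F (Suc n))) \<le> lam"
    by (simp add: A d_def norm_mult del: of_nat_Suc)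
  moreover have "0 < real n * real (Suc n)" using n by simp
  ultimately show ?thesis by (simp only: pos_le_divide_eq mult_ac)
qed

text \<open>
The coefficient bounds are dominated by a telescoping series with sum 1, which gives
\<open>|f z - z| \<le> |z|\<^sup>2 < |z|\<close>.
\<close>

lemma class_G_nonzero:
  assumes lam: "0 < lam" "lam \<le> 1" and f: "f \<in> class_G lam"
    and z: "z \<in> unit_disc" "z \<noteq> 0"
  shows "f z \<noteq> 0"
proof -
  obtain F where F: "f has_fps_expansion F" "fps_nth F 1 = 1"
    and sums: "(\<lambda>n. fps_nth F (n + 2) * z ^ (n + 2)) sums (f z - z)"
  proof (rule class_A_fps [of f])
    show "f \<in> class_A" using f by (simp add: class_G_def)
  qed (use z in blast)
  have "(\<lambda>n. inverse (real (Suc n)) - inverse (real (Suc (Suc n)))) sums (inverse (real (Suc 0)) - 0)"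
    by (intro telescope_sums' LIMSEQ_inverse_real_of_nat)
  hence "(\<lambda>n. (norm z)\<^sup>2 * (inverse (real (Suc n)) - inverse (real (Suc (Suc n)))))
      sums ((norm z)\<^sup>2 * (inverse (real (Suc 0)) - 0))" by (rule sums_mult)
  hence tele: "(\<lambda>n. (norm z)\<^sup>2 * (1 / (real (Suc n) * real (Suc (Suc n))))) sums (norm z)\<^sup>2"
    by (simp add: field_simps)
  have "norm (fps_nth F (n + 2) * z ^ (n + 2)) \<le> (norm z)\<^sup>2 * (1 / (real (Suc n) * real (Suc (Suc n))))" for n
  proof -
    have "norm (fps_nth F (n + 2)) \<le> lam / (real (Suc n) * real (Suc (Suc n)))"
      using class_G_coeff_bound[OF lam f F, of "Suc n"] by simp
    also have "\<dots> \<le> 1 / (real (Suc n) * real (Suc (Suc n)))"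
      using lam by (intro divide_right_mono) auto
    finally have "norm (fps_nth F (n + 2)) * (norm z) ^ (n + 2)
        \<le> 1 / (real (Suc n) * real (Suc (Suc n))) * (norm z)\<^sup>2"
      using z by (intro mult_mono power_decreasing) auto
    thus ?thesis by (simp add: norm_mult norm_power mult.commute)
  qed
  from norm_suminf_le [OF this sums_summable [OF tele]]
  have "norm (f z - z) \<le> (norm z)\<^sup>2"
    by (simp only: sums_unique [OF sums, symmetric] sums_unique [OF tele, symmetric])
  also have "\<dots> < norm z" using z by (simp add: power2_eq_square)
  finally show ?thesis by auto
qed

section \<open>The logarithm of f(z)/z and its coefficients\<close>

lemma log_branch_exists:
  assumes "0 < lam" "lam \<le> 1" "f \<in> class_G lam"
  obtains L where "is_log_branch f L"
proof -
  have hol: "f holomorphic_on unit_disc" and A: "f \<in> class_A"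
    using assms(3) by (simp_all add: class_G_def class_A_def)
  obtain F where F: "f has_fps_expansion F" "fps_nth F 0 = 0" "fps_nth F 1 = 1"
    using class_A_fps[OF A] by metis
  have "f 0 = 0" "deriv f 0 = 1"
    using F has_fps_expansion_imp_0_eq_fps_nth_0[OF F(1)]
      has_fps_expansion_imp_0_eq_fps_nth_0[OF has_fps_expansion_deriv[OF F(1)]] by simp_all
  define s where "s z = (if z = 0 then 1 else f z / z)" for z
  have hol_s: "s holomorphic_on unit_disc"
    by (rule pole_theorem_open_0[OF hol, of 0]) (simp_all add: s_def \<open>f 0 = 0\<close> \<open>deriv f 0 = 1\<close>)
  have s_nonzero: "s z \<noteq> 0" if "z \<in> unit_disc" for z
    using class_G_nonzero[OF assms that] by (simp add: s_def)
  obtain M where M: "M holomorphic_on unit_disc" "\<And>z. z \<in> unit_disc \<Longrightarrow> exp (M z) = s z"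
    by (rule holomorphic_logarithm_exists[OF convex_ball open_ball hol_s s_nonzero, of 0]) auto
  have "exp (M 0) = 1" using M(2)[of 0] by (simp add: s_def)
  hence "is_log_branch f (\<lambda>z. M z - M 0)"
    unfolding is_log_branch_def using M by (auto simp: exp_diff s_def intro!: holomorphic_intros)
  thus ?thesis by (rule that)
qed

text \<open>
The exponential of \<open>L - M\<close> is constantly 1, so the derivative of \<open>L - M\<close> vanishes.
\<close>

lemma log_branch_unique:
  assumes L: "is_log_branch f L" and M: "is_log_branch f M" and z: "z \<in> unit_disc"
  shows "L z = M z"
proof -
  have hol: "L holomorphic_on unit_disc" "M holomorphic_on unit_disc" and zero: "L 0 = 0" "M 0 = 0"
    using L M by (simp_all add: is_log_branch_def)
  have one: "exp (L w - M w) = 1" if "w \<in> unit_disc" for w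
  proof -
    have "exp (L w) = exp (M w)"
      using L M that by (cases "w = 0") (auto simp: is_log_branch_def)
    thus ?thesis by (simp add: exp_diff)
  qed
  have "\<exists>c. \<forall>w\<in>unit_disc. L w - M w = c"
  proof (rule has_field_derivative_zero_constant)
    fix w :: complex assume w: "w \<in> unit_disc"
    let ?d = "deriv L w - deriv M w"
    have der: "((\<lambda>w. L w - M w) has_field_derivative ?d) (at w)"
      using hol w by (intro derivative_intros holomorphic_derivI[of _ unit_disc]) auto
    have "((\<lambda>w. exp (L w - M w)) has_field_derivative exp (L w - M w) * ?d) (at w)"
      by (rule DERIV_fun_exp [OF der])
    moreover have "((\<lambda>w. exp (L w - M w)) has_field_derivative 0) (at w)"
      by (rule has_field_derivative_transform_within_open[OF DERIV_const[of 1] open_ball w])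
         (simp add: one)
    ultimately have "?d = 0" using DERIV_unique by fastforce
    with der show "((\<lambda>w. L w - M w) has_field_derivative 0) (at w within unit_disc)"
      by (simp add: has_field_derivative_at_within)
  qed auto
  then obtain c where c: "\<And>w. w \<in> unit_disc \<Longrightarrow> L w - M w = c" by blast
  show ?thesis using c[OF z] c[of 0] zero by simp
qed

text \<open>
Uniqueness of the branch and of power series coefficients identifies the definite description with the
halved Taylor coefficients of any branch.
\<close>

lemma log_coeff_eq:
  assumes L: "is_log_branch f L" and A: "L has_fps_expansion A"
  shows "log_coeff f n = fps_nth A n / 2"
proof -
  have hol: "L holomorphic_on unit_disc" and "L 0 = 0" using L by (simp_all add: is_log_branch_def)
  hence A0: "fps_nth A 0 = 0" using has_fps_expansion_imp_0_eq_fps_nth_0[OF A] by simp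
  have "log_coeff f = (\<lambda>n. fps_nth A n / 2)"
    unfolding log_coeff_def
  proof (rule the_equality)
    have "(\<lambda>n. fps_nth A (Suc n) * z ^ Suc n) sums L z" if "z \<in> unit_disc" for z
      using holomorphic_unit_disc_series(1)[OF A hol, of z] that A0
        sums_Suc_iff[of "\<lambda>k. fps_nth A k * z ^ k" "L z"] by simp
    thus "fps_nth A 0 / 2 = 0 \<and> (\<exists>L. is_log_branch f L \<and>
        (\<forall>z\<in>unit_disc. (\<lambda>n. 2 * (fps_nth A (Suc n) / 2) * z ^ Suc n) sums L z))"
      using L A0 by auto
  next
    fix \<gamma> assume \<gamma>: "\<gamma> 0 = 0 \<and> (\<exists>L. is_log_branch f L \<and>
        (\<forall>z\<in>unit_disc. (\<lambda>n. 2 * \<gamma> (Suc n) * z ^ Suc n) sums L z))"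
    then obtain M where M: "is_log_branch f M"
      "\<And>z. z \<in> unit_disc \<Longrightarrow> (\<lambda>n. 2 * \<gamma> (Suc n) * z ^ Suc n) sums M z" by blast
    have "(\<lambda>n. 2 * \<gamma> n * z ^ n) sums L z" if "z \<in> unit_disc" for z
      using M(2)[OF that] log_branch_unique[OF L M(1) that] \<gamma>
        sums_Suc_iff[of "\<lambda>n. 2 * \<gamma> n * z ^ n" "L z"] by simp
    hence "L has_fps_expansion Abs_fps (\<lambda>n. 2 * \<gamma> n)"
      by (intro has_fps_expansionI eventually_nhds_in_open[of unit_disc 0, THEN eventually_mono]) auto
    hence "A = Abs_fps (\<lambda>n. 2 * \<gamma> n)" using A fps_expansion_unique_complex by blast
    thus "\<gamma> = (\<lambda>n. fps_nth A n / 2)" by auto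
  qed
  thus ?thesis by simp
qed

lemma fps_X_deriv_nth: "fps_nth (fps_X * fps_deriv A) n = of_nat n * fps_nth (A :: complex fps) n"
  by (cases n) auto

lemma log_derivative_expansion:
  assumes L: "is_log_branch f L" and A: "L has_fps_expansion A"
  shows "(\<lambda>z. z * deriv L z) has_fps_expansion fps_X * fps_deriv A"
    and "norm (log_coeff f n) = norm (fps_nth (fps_X * fps_deriv A) n) / (2 * real n)"
proof -
  have "L 0 = 0" using L by (simp add: is_log_branch_def)
  show "(\<lambda>z. z * deriv L z) has_fps_expansion fps_X * fps_deriv A"
    by (intro fps_expansion_intros A)
  have "fps_nth A 0 = 0"
    using has_fps_expansion_imp_0_eq_fps_nth_0[OF A] \<open>L 0 = 0\<close> by simp
  thus "norm (log_coeff f n) = norm (fps_nth (fps_X * fps_deriv A) n) / (2 * real n)"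
    unfolding fps_X_deriv_nth log_coeff_eq[OF L A] by (cases "n = 0") (auto simp: norm_mult norm_divide)
qed

text \<open>
This is the Riccati equation for \<open>g = z f' / f - 1\<close>, read off from \<open>f' = exp L * (1 + g)\<close>; this
formula also shows that \<open>1 + g\<close> vanishes only where \<open>f'\<close> does.
\<close>

lemma log_derivative_equation:
  fixes L :: "complex \<Rightarrow> complex"
  defines "g \<equiv> \<lambda>z. z * deriv L z"
  assumes L: "is_log_branch f L" and f0: "f 0 = 0"
    and f': "deriv f z \<noteq> 0" and z: "z \<in> unit_disc"
  shows "1 + g z \<noteq> 0"
    and "g z + g z * g z + z * deriv g z = z * deriv (deriv f) z / deriv f z * (1 + g z)"
proof -
  have hol: "L holomorphic_on unit_disc" using L by (simp add: is_log_branch_def)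
  have hol': "deriv L holomorphic_on unit_disc" using hol by (rule holomorphic_deriv) simp
  have holg: "g holomorphic_on unit_disc" unfolding g_def by (intro holomorphic_intros hol')
  have feq: "f w = w * exp (L w)" if "w \<in> unit_disc" for w
    using L f0 that by (cases "w = 0") (auto simp: is_log_branch_def)
  have d1: "deriv f w = exp (L w) * (1 + g w)" if w: "w \<in> unit_disc" for w
  proof (rule DERIV_imp_deriv, rule has_field_derivative_transform_within_open [where S = unit_disc])
    show "((\<lambda>w. w * exp (L w)) has_field_derivative exp (L w) * (1 + g w)) (at w)"
      using holomorphic_derivI[OF hol open_ball w]
      by (auto intro!: derivative_eq_intros simp: g_def algebra_simps)
  qed (use w feq in auto)
  have d2: "deriv (deriv f) z = exp (L z) * (deriv L z * (1 + g z) + deriv g z)"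
  proof (rule DERIV_imp_deriv, rule has_field_derivative_transform_within_open [where S = unit_disc])
    show "((\<lambda>w. exp (L w) * (1 + g w)) has_field_derivative
        exp (L z) * (deriv L z * (1 + g z) + deriv g z)) (at z)"
      using holomorphic_derivI[OF hol open_ball z] holomorphic_derivI[OF holg open_ball z]
      by (auto intro!: derivative_eq_intros simp: algebra_simps)
  qed (use z d1 in auto)
  show nz: "1 + g z \<noteq> 0" using f' d1[OF z] by auto
  have "z * deriv (deriv f) z / deriv f z * (1 + g z) = z * (deriv L z * (1 + g z) + deriv g z)"
    unfolding d1[OF z] d2 using nz by simp
  thus "g z + g z * g z + z * deriv g z = z * deriv (deriv f) z / deriv f z * (1 + g z)"
    by (simp add: g_def algebra_simps)
qed

lemma riccati_coeff:
  fixes G :: "complex fps"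
  shows "fps_nth (G + G * G + fps_X * fps_deriv G) k
    = of_nat (Suc k) * fps_nth G k + (\<Sum>i\<le>k. fps_nth G i * fps_nth G (k - i))"
  unfolding fps_add_nth fps_X_deriv_nth fps_mult_nth [of G G] atLeast0AtMost
  by (simp add: algebra_simps)

section \<open>Cubic sums of a small sequence\<close>

text \<open>
There are \<open>2 m - 1\<close> pairs of positive integers with maximum \<open>m\<close>.
\<close>

lemma sum_max_square:
  fixes y :: "nat \<Rightarrow> real"
  shows "(\<Sum>i\<in>{1..<n}. \<Sum>j\<in>{1..<n}. y (max i j)) = (\<Sum>m\<in>{1..<n}. (2 * real m - 1) * y m)"
proof (induction n)
  case (Suc n)
  show ?case
  proof (cases "n = 0")
    case False
    have "(\<Sum>i\<in>{1..<n}. y (max i n)) = (\<Sum>i\<in>{1..<n}. y n)"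
         "(\<Sum>j\<in>{1..<n}. y (max n j)) = (\<Sum>j\<in>{1..<n}. y n)"
      by (intro sum.cong refl; simp)+
    thus ?thesis using False Suc.IH
      by (simp add: sum.atLeastLessThan_Suc sum.distrib of_nat_diff algebra_simps)
  qed simp
qed simp

text \<open>
The map sending \<open>(k, i)\<close> to \<open>(i, k - i)\<close> embeds the triangle into the square.
\<close>

lemma sum_triangle_max_le:
  fixes y :: "nat \<Rightarrow> real"
  assumes "\<And>i. y i \<ge> 0"
  shows "(\<Sum>k<n. \<Sum>i\<in>{1..<k}. y (max i (k - i))) \<le> (\<Sum>m\<in>{1..<n}. (2 * real m - 1) * y m)"
proof -
  have "(\<Sum>k<n. \<Sum>i\<in>{1..<k}. y (max i (k - i)))
      = (\<Sum>(k, i)\<in>(SIGMA k:{..<n}. {1..<k}). y (max i (k - i)))"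
    by (rule sum.Sigma) auto
  also have "\<dots> \<le> (\<Sum>(i, j)\<in>{1..<n} \<times> {1..<n}. y (max i j))"
  proof (rule sum_le_included[where i = "\<lambda>(i, j). (i + j, i)"])
    show "\<forall>p\<in>(SIGMA k:{..<n}. {1..<k}). \<exists>q\<in>{1..<n} \<times> {1..<n}. (case q of (i, j) \<Rightarrow> (i + j, i)) = p \<and>
        (case p of (k, i) \<Rightarrow> y (max i (k - i))) \<le> (case q of (i, j) \<Rightarrow> y (max i j))"
    proof
      fix p assume "p \<in> (SIGMA k:{..<n}. {1..<k})"
      then obtain k i where "p = (k, i)" "k < n" "1 \<le> i" "i < k" by auto
      thus "\<exists>q\<in>{1..<n} \<times> {1..<n}. (case q of (i, j) \<Rightarrow> (i + j, i)) = p \<and>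
        (case p of (k, i) \<Rightarrow> y (max i (k - i))) \<le> (case q of (i, j) \<Rightarrow> y (max i j))"
        by (intro bexI[of _ "(i, k - i)"]) auto
    qed
  qed (use assms in auto)
  also have "\<dots> = (\<Sum>m\<in>{1..<n}. (2 * real m - 1) * y m)"
    by (simp only: sum.cartesian_product [symmetric] sum_max_square)
  finally show ?thesis .
qed

lemma triple_product_le:
  fixes u v w :: real
  assumes "0 \<le> u" "0 \<le> v" "0 \<le> w" "u \<le> 1 / 2"
  shows "u * v * w \<le> (w\<^sup>2 + v\<^sup>2) / 4"
proof -
  have "u * (v * w) \<le> (1 / 2) * (v * w)" using assms by (intro mult_right_mono) auto
  moreover have "2 * (v * w) \<le> v\<^sup>2 + w\<^sup>2" using sum_squares_bound[of v w] by simp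
  ultimately show ?thesis by (simp add: mult.assoc)
qed

lemma convolution_trim:
  fixes x :: "nat \<Rightarrow> real"
  assumes "x 0 = 0"
  shows "(\<Sum>i\<le>k. x i * x (k - i)) = (\<Sum>i\<in>{1..<k}. x i * x (k - i))"
proof (rule sum.mono_neutral_right)
  show "\<forall>i\<in>{..k} - {1..<k}. x i * x (k - i) = 0"
  proof
    fix i assume "i \<in> {..k} - {1..<k}"
    hence "i = 0 \<or> i = k" by auto
    thus "x i * x (k - i) = 0" using assms by auto
  qed
qed auto

text \<open>
In each product \<open>x\<^sub>i x\<^sub>j x\<^sub>k\<close> with \<open>i + j = k\<close>, bound the factor with the smaller index among \<open>i, j\<close> by 1/2 and
apply the inequality of means to the other two.  The square of \<open>x\<^sub>m\<close> then arises \<open>m - 1\<close> times with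
\<open>m = k\<close> and at most \<open>2 m - 1\<close> times with \<open>m = max i j\<close>, each time with weight 1/4, and
\<open>(3 m - 2) / 4 \<le> m - 1 / 2\<close> for \<open>m \<ge> 1\<close>.  Sparing the smaller index matters: the first
coefficients have the least room in the final estimate.
\<close>

lemma convolution_triple_sum_le:
  fixes x :: "nat \<Rightarrow> real"
  assumes nonneg: "\<And>i. x i \<ge> 0" and zero: "x 0 = 0" and half: "\<And>i. i < n \<Longrightarrow> x i \<le> 1 / 2"
  shows "(\<Sum>k<n. (\<Sum>i\<le>k. x i * x (k - i)) * x k) \<le> (\<Sum>k<n. (real k - 1 / 2) * (x k)\<^sup>2)"
proof -
  \<comment> \<open>In either case below the index \<open>max i (k - i)\<close> is the one that keeps its square.\<close>
  have "(\<Sum>k<n. (\<Sum>i\<le>k. x i * x (k - i)) * x k)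
      \<le> (\<Sum>k<n. \<Sum>i\<in>{1..<k}. ((x k)\<^sup>2 + (x (max i (k - i)))\<^sup>2) / 4)"
    unfolding convolution_trim[of x, OF zero] sum_distrib_right
  proof (intro sum_mono)
    fix k i assume k: "k \<in> {..<n}" and i: "i \<in> {1..<k}"
    show "x i * x (k - i) * x k \<le> ((x k)\<^sup>2 + (x (max i (k - i)))\<^sup>2) / 4"
    proof (cases "i \<le> k - i")
      case True
      thus ?thesis using triple_product_le[of "x i" "x (k - i)" "x k"] nonneg half k i by simp
    next
      case False
      hence "max i (k - i) = i" by simp
      moreover have "x (k - i) \<le> 1 / 2" using k i by (intro half) auto
      ultimately show ?thesis using triple_product_le[of "x (k - i)" "x i" "x k"] nonneg
        by (simp add: mult.commute)
    qed
  qed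
  also have "\<dots> = (\<Sum>k<n. real (k - 1) / 4 * (x k)\<^sup>2) + (\<Sum>k<n. \<Sum>i\<in>{1..<k}. (x (max i (k - i)))\<^sup>2) / 4"
    by (simp add: add_divide_distrib sum.distrib sum_divide_distrib)
  also have "(\<Sum>k<n. \<Sum>i\<in>{1..<k}. (x (max i (k - i)))\<^sup>2) \<le> (\<Sum>m\<in>{1..<n}. (2 * real m - 1) * (x m)\<^sup>2)"
    by (rule sum_triangle_max_le) simp
  also have "(\<Sum>m\<in>{1..<n}. (2 * real m - 1) * (x m)\<^sup>2) = (\<Sum>m<n. (2 * real m - 1) * (x m)\<^sup>2)"
    by (rule sum.mono_neutral_left) (auto simp: zero not_le)
  also have "(\<Sum>k<n. real (k - 1) / 4 * (x k)\<^sup>2) + (\<Sum>m<n. (2 * real m - 1) * (x m)\<^sup>2) / 4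
      = (\<Sum>k<n. (real (k - 1) + (2 * real k - 1)) / 4 * (x k)\<^sup>2)"
    by (simp add: sum_divide_distrib sum.distrib [symmetric] add_divide_distrib distrib_right)
  also have "\<dots> \<le> (\<Sum>k<n. (real k - 1 / 2) * (x k)\<^sup>2)"
  proof (rule sum_mono)
    fix k
    show "(real (k - 1) + (2 * real k - 1)) / 4 * (x k)\<^sup>2 \<le> (real k - 1 / 2) * (x k)\<^sup>2"
      using zero by (cases k) (auto intro!: mult_right_mono simp: field_simps)
  qed
  finally show ?thesis by simp
qed

lemma convolution_le_sum_squares:
  fixes x :: "nat \<Rightarrow> real"
  assumes "x 0 = 0"
  shows "(\<Sum>i\<le>n. x i * x (n - i)) \<le> (\<Sum>i<n. (x i)\<^sup>2)"
proof -
  have "(\<Sum>i\<in>{1..<n}. x i * x (n - i)) \<le> (\<Sum>i\<in>{1..<n}. ((x i)\<^sup>2 + (x (n - i))\<^sup>2) / 2)"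
  proof (rule sum_mono)
    fix i show "x i * x (n - i) \<le> ((x i)\<^sup>2 + (x (n - i))\<^sup>2) / 2"
      using sum_squares_bound[of "x i" "x (n - i)"] by simp
  qed
  also have "\<dots> = (\<Sum>i\<in>{1..<n}. (x i)\<^sup>2) / 2 + (\<Sum>i\<in>{1..<n}. (x (n - i))\<^sup>2) / 2"
    by (simp add: add_divide_distrib sum.distrib sum_divide_distrib)
  also have "(\<Sum>i\<in>{1..<n}. (x (n - i))\<^sup>2) = (\<Sum>i\<in>{1..<n}. (x i)\<^sup>2)"
    by (rule sum.reindex_bij_witness[of _ "\<lambda>i. n - i" "\<lambda>i. n - i"]) auto
  also have "(\<Sum>i\<in>{1..<n}. (x i)\<^sup>2) = (\<Sum>i<n. (x i)\<^sup>2)"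
    by (rule sum.mono_neutral_left) (auto simp: assms not_le)
  finally show ?thesis unfolding convolution_trim[of x, OF assms] by simp
qed

section \<open>The upper bound\<close>

text \<open>
The estimate at the heart of the upper bound, stated for sequences: \<open>b\<close> are the coefficients of \<open>g\<close>,
\<open>c\<close> those of \<open>g\<^sup>2\<close> and \<open>A\<close> those of \<open>g + g\<^sup>2 + z g'\<close>.  With \<open>x\<^sub>k = |b\<^sub>k|\<close> and \<open>D\<close> the sum of \<open>x\<^sub>k\<^sup>2\<close> over
\<open>k < n\<close>, Clunie's inequality loses at least \<open>2 \<lambda> D\<close> against \<open>\<lambda>\<^sup>2\<close>, because the linear part of \<open>A\<^sub>k\<close> carries
the factor \<open>k + 1\<close> and the convolution consumes at most \<open>k - 1/2\<close> of it.  Hence \<open>|A\<^sub>n| \<le> \<lambda> - D\<close>,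
which absorbs \<open>|c\<^sub>n| \<le> D\<close>.
\<close>

lemma clunie_quadratic_coeff_bound:
  fixes b c A :: "nat \<Rightarrow> complex" and lam :: real
  defines "c \<equiv> \<lambda>k. \<Sum>i\<le>k. b i * b (k - i)"
  defines "A \<equiv> \<lambda>k. of_nat (Suc k) * b k + c k"
  assumes lam: "0 < lam" "lam \<le> 1" and b0: "b 0 = 0"
    and clunie: "\<And>n. (\<Sum>k\<le>n. (norm (A k))\<^sup>2)
      \<le> (\<Sum>k<n. (norm (A k - of_real lam * (if k = 0 then 1 else b k)))\<^sup>2)"
    and n: "n \<ge> 1"
  shows "real (Suc n) * norm (b n) \<le> lam"
  using n
proof (induction n rule: less_induct)
  case (less n)
  define x where "x i = norm (b i)" for i
  define D where "D = (\<Sum>k<n. (x k)\<^sup>2)"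
  have x0: "x 0 = 0" by (simp add: x_def b0)
  have A0: "A 0 = 0" by (simp add: A_def c_def b0)
  have half: "x i \<le> 1 / 2" if "i < n" for i
  proof (cases "i = 0")
    case False
    have "2 * x i \<le> real (Suc i) * x i" using False by (intro mult_right_mono) (auto simp: x_def)
    also have "\<dots> \<le> 1" using less.IH[OF that] False lam by (simp add: x_def)
    finally show ?thesis by simp
  qed (simp add: x0)
  have cx: "norm (c k) \<le> (\<Sum>i\<le>k. x i * x (k - i))" for k
    unfolding c_def x_def by (rule sum_norm_le) (simp add: norm_mult)
  \<comment> \<open>The estimate \<open>\<lambda>\<^sup>2 x\<^sub>k\<^sup>2 \<le> \<lambda> x\<^sub>k\<^sup>2\<close> lowers the factor from \<open>k + 1\<close> to \<open>k + 1/2\<close>.\<close>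
  have step: "(norm (A k - of_real lam * (if k = 0 then 1 else b k)))\<^sup>2
      \<le> (norm (A k))\<^sup>2 + ((if k = 0 then lam\<^sup>2 else 0)
        - 2 * lam * ((real k + 1 / 2) * (x k)\<^sup>2 - (\<Sum>i\<le>k. x i * x (k - i)) * x k))" for k
  proof (cases "k = 0")
    case False
    have expand: "(norm (A k - of_real lam * b k))\<^sup>2 = (norm (A k))\<^sup>2 + lam * (lam * (x k)\<^sup>2 - 2 * Re (A k * cnj (b k)))"
      unfolding x_def cmod_power2 by (simp add: power2_eq_square algebra_simps)
    have "lam * (x k)\<^sup>2 \<le> 1 * (x k)\<^sup>2" using lam by (intro mult_right_mono) auto
    moreover have "Re (A k * cnj (b k)) = real (Suc k) * (x k)\<^sup>2 + Re (c k * cnj (b k))"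
      unfolding A_def x_def cmod_power2 by (simp add: power2_eq_square algebra_simps)
    moreover have "- ((\<Sum>i\<le>k. x i * x (k - i)) * x k) \<le> Re (c k * cnj (b k))"
    proof -
      have "\<bar>Re (c k * cnj (b k))\<bar> \<le> norm (c k) * x k"
        using abs_Re_le_cmod[of "c k * cnj (b k)"] by (simp add: norm_mult x_def)
      also have "\<dots> \<le> (\<Sum>i\<le>k. x i * x (k - i)) * x k"
        using cx[of k] by (intro mult_right_mono) (auto simp: x_def)
      finally show ?thesis by linarith
    qed
    ultimately have "lam * (x k)\<^sup>2 - 2 * Re (A k * cnj (b k))
        \<le> - 2 * ((real k + 1 / 2) * (x k)\<^sup>2 - (\<Sum>i\<le>k. x i * x (k - i)) * x k)"
      by (simp add: algebra_simps)
    from mult_left_mono[OF this, of lam] lam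
    have "lam * (lam * (x k)\<^sup>2 - 2 * Re (A k * cnj (b k)))
        \<le> lam * (- 2 * ((real k + 1 / 2) * (x k)\<^sup>2 - (\<Sum>i\<le>k. x i * x (k - i)) * x k))" by simp
    moreover have "lam * (- 2 * T) = - (2 * lam * T)" for T by simp
    ultimately show ?thesis using expand False
      by (simp only: if_False diff_0 add_left_mono)
  qed (use A0 x0 lam in simp)
  have "(\<Sum>k<n. (norm (A k))\<^sup>2) + (norm (A n))\<^sup>2
      \<le> (\<Sum>k<n. (norm (A k - of_real lam * (if k = 0 then 1 else b k)))\<^sup>2)"
    using clunie[of n] by (simp add: lessThan_Suc_atMost [symmetric])
  also have "\<dots> \<le> (\<Sum>k<n. (norm (A k))\<^sup>2 + ((if k = 0 then lam\<^sup>2 else 0)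
        - 2 * lam * ((real k + 1 / 2) * (x k)\<^sup>2 - (\<Sum>i\<le>k. x i * x (k - i)) * x k)))"
    by (intro sum_mono step)
  also have "\<dots> = (\<Sum>k<n. (norm (A k))\<^sup>2) + (lam\<^sup>2 - 2 * lam *
      ((\<Sum>k<n. (real k + 1 / 2) * (x k)\<^sup>2) - (\<Sum>k<n. (\<Sum>i\<le>k. x i * x (k - i)) * x k)))"
    using less.prems by (simp add: sum.distrib sum_subtractf sum_distrib_left [symmetric])
  finally have "(norm (A n))\<^sup>2 \<le> lam\<^sup>2 - 2 * lam *
      ((\<Sum>k<n. (real k + 1 / 2) * (x k)\<^sup>2) - (\<Sum>k<n. (\<Sum>i\<le>k. x i * x (k - i)) * x k))" by simp
  also have "\<dots> \<le> lam\<^sup>2 - 2 * lam * D"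
  proof -
    have "(\<Sum>k<n. (\<Sum>i\<le>k. x i * x (k - i)) * x k) \<le> (\<Sum>k<n. (real k - 1 / 2) * (x k)\<^sup>2)"
      by (rule convolution_triple_sum_le) (use half x0 in \<open>auto simp: x_def\<close>)
    also have "\<dots> = (\<Sum>k<n. (real k + 1 / 2) * (x k)\<^sup>2) - D"
      unfolding D_def sum_subtractf [symmetric] by (simp add: algebra_simps)
    finally show ?thesis using lam by simp
  qed
  finally have An: "(norm (A n))\<^sup>2 \<le> lam\<^sup>2 - 2 * lam * D" .
  \<comment> \<open>Taking square roots below needs \<open>D \<le> \<lambda>\<close>, which comes for free from \<open>|A\<^sub>n|\<^sup>2 \<ge> 0\<close>.\<close>
  hence "0 \<le> lam * (lam - 2 * D)"
    using order_trans[OF zero_le_power2 An] by (simp add: power2_eq_square algebra_simps)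
  hence "D \<le> lam" using lam by (simp add: zero_le_mult_iff sum_nonneg)
  moreover have "(norm (A n))\<^sup>2 \<le> (lam - D)\<^sup>2"
    using An by (simp add: power2_diff) (smt (verit) zero_le_power2)
  ultimately have "norm (A n) \<le> lam - D" using power2_le_imp_le by simp
  moreover have "norm (c n) \<le> D"
    using cx[of n] convolution_le_sum_squares[of x n, OF x0] by (simp add: D_def)
  moreover have "real (Suc n) * norm (b n) = norm (A n - c n)"
    by (simp add: A_def norm_mult del: of_nat_Suc)
  ultimately show ?case using norm_triangle_ineq4[of "A n" "c n"] by linarith
qed

lemma class_G_log_derivative_coeff_bound:
  assumes lam: "0 < lam" "lam \<le> 1" and f: "f \<in> class_G lam"
    and L: "is_log_branch f L" and G: "(\<lambda>z. z * deriv L z) has_fps_expansion G" and n: "n \<ge> 1"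
  shows "real (Suc n) * norm (fps_nth G n) \<le> lam"
proof -
  define g where "g z = z * deriv L z" for z
  have f0: "f 0 = 0" using f by (rule class_G_zero)
  have hol: "g holomorphic_on unit_disc"
    using L unfolding g_def is_log_branch_def by (intro holomorphic_intros holomorphic_deriv) auto
  have g: "g has_fps_expansion G" using G unfolding g_def [abs_def] .
  define H where "H = G + G * G + fps_X * fps_deriv G"
  define B where "B = H - fps_const (of_real lam) * (1 + G)"
  have G0: "fps_nth G 0 = 0"
    using has_fps_expansion_imp_0_eq_fps_nth_0[OF g] by (simp add: g_def)
  have H: "fps_nth H k = of_nat (Suc k) * fps_nth G k + (\<Sum>i\<le>k. fps_nth G i * fps_nth G (k - i))" for k
    unfolding H_def by (rule riccati_coeff)
  have B: "fps_nth B k = fps_nth H k - of_real lam * (if k = 0 then 1 else fps_nth G k)" for k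
    by (simp add: B_def G0)
  have "(\<Sum>k\<le>m. (norm (fps_nth H k))\<^sup>2) \<le> (\<Sum>k<m. (norm (fps_nth B k))\<^sup>2)" for m
  proof (rule clunie)
    show "(\<lambda>z. g z + g z * g z + z * deriv g z) has_fps_expansion H"
      unfolding H_def by (intro fps_expansion_intros g)
    show "(\<lambda>z. g z + g z * g z + z * deriv g z - of_real lam * (1 + g z)) has_fps_expansion B"
      unfolding B_def H_def by (intro fps_expansion_intros g)
    show "g 0 + g 0 * g 0 + 0 * deriv g 0 = 0" by (simp add: g_def)
    fix z assume z: "z \<in> unit_disc"
    have f': "deriv f z \<noteq> 0" and Re: "Re (z * deriv (deriv f) z / deriv f z) < lam / 2"
      using f z by (auto simp: class_G_def)
    from log_derivative_equation[OF L f0 f' z, folded g_def]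
      norm_half_plane_mult_less[OF lam(1) Re, of "1 + g z"]
    show "norm (g z + g z * g z + z * deriv g z)
        < norm (g z + g z * g z + z * deriv g z - of_real lam * (1 + g z))" by simp
  qed (auto intro!: holomorphic_intros holomorphic_deriv hol)
  from this[unfolded B H] show ?thesis
    by (rule clunie_quadratic_coeff_bound[where b = "fps_nth G", OF lam G0 _ n])
qed

section \<open>Extremal functions\<close>

text \<open>
The function is the primitive of \<open>(1 - z\<^sup>n)\<close> to the power \<open>\<lambda> / n\<close>; the exponent is chosen so that the
derivative of \<open>log f'\<close> has no factor \<open>n\<close>.
\<close>

lemma extremal_in_class_G:
  fixes lam :: real and n :: nat
  assumes lam: "0 < lam" and n: "n \<ge> 1"
  obtains f where "f \<in> class_G lam"
    "\<And>z. z \<in> unit_disc \<Longrightarrow> z * deriv (deriv f) z / deriv f z = - of_real lam * z ^ n / (1 - z ^ n)"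
proof -
  define h :: "complex \<Rightarrow> complex" where "h z = exp (of_real (lam / real n) * Ln (1 - z ^ n))" for z
  have Re_pos: "0 < Re (1 - z ^ n)" if "z \<in> unit_disc" for z
  proof -
    have "norm (z ^ n) < 1" using that n by (simp add: norm_power power_less_one_iff)
    thus ?thesis using complex_Re_le_cmod[of "z ^ n"] by simp
  qed
  have slit: "1 - z ^ n \<notin> \<real>\<^sub>\<le>\<^sub>0" if "z \<in> unit_disc" for z
    using Re_pos[OF that] by (auto simp: complex_nonpos_Reals_iff)
  have hol_h: "h holomorphic_on unit_disc"
    unfolding h_def using slit by (intro holomorphic_intros) auto
  obtain p where p: "\<And>z. z \<in> unit_disc \<Longrightarrow> (p has_field_derivative h z) (at z within unit_disc)"
    using holomorphic_convex_primitive'[OF convex_ball open_ball hol_h] by blast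
  define f where "f z = p z - p 0" for z
  have f: "(f has_field_derivative h z) (at z)" if "z \<in> unit_disc" for z
    using p[OF that] that unfolding f_def
    by (auto intro!: derivative_eq_intros simp: at_within_open[OF that open_ball])
  have hol: "f holomorphic_on unit_disc"
    using f by (intro holomorphic_onI) (auto simp: field_differentiable_def intro: has_field_derivative_at_within)
  have d1: "deriv f z = h z" if "z \<in> unit_disc" for z
    using f[OF that] by (rule DERIV_imp_deriv)
  have d2: "deriv (deriv f) z = h z * (- of_real lam * z ^ (n - 1) / (1 - z ^ n))"
    if z: "z \<in> unit_disc" for z
  proof (rule DERIV_imp_deriv, rule has_field_derivative_transform_within_open [where S = unit_disc])
    have nz: "1 - z ^ n \<noteq> 0" using slit[OF z] by auto
    show "(h has_field_derivative h z * (- of_real lam * z ^ (n - 1) / (1 - z ^ n))) (at z)"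
      unfolding h_def using slit[OF z] nz n
      by (auto intro!: derivative_eq_intros simp: field_simps)
  qed (use z d1 in auto)
  have ratio: "z * deriv (deriv f) z / deriv f z = - of_real lam * z ^ n / (1 - z ^ n)"
    if "z \<in> unit_disc" for z
  proof -
    have "h z \<noteq> 0" by (simp add: h_def)
    hence "z * (h z * (- of_real lam * z ^ (n - 1) / (1 - z ^ n))) / h z
        = - of_real lam * (z * z ^ (n - 1)) / (1 - z ^ n)" by simp
    also have "z * z ^ (n - 1) = z ^ n" using n by (metis power_eq_if not_one_le_zero)
    finally show ?thesis unfolding d1[OF that] d2[OF that] .
  qed
  have "f \<in> class_A"
  proof -
    define F where "F = fps_expansion f 0"
    have F: "f has_fps_expansion F"
      unfolding F_def by (rule has_fps_expansion_fps_expansion[OF _ _ hol]) auto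
    have "fps_nth F 0 = 0"
      using has_fps_expansion_imp_0_eq_fps_nth_0[OF F] by (simp add: f_def)
    moreover have "fps_nth F 1 = 1"
      using has_fps_expansion_imp_0_eq_fps_nth_0[OF has_fps_expansion_deriv[OF F]] d1[of 0] n
      by (simp add: h_def power_0_left)
    ultimately have "(\<lambda>k. fps_nth F (k + 2) * z ^ (k + 2)) sums (f z - z)" if "z \<in> unit_disc" for z
      using holomorphic_unit_disc_series(1)[OF F hol, of z] that
        sums_iff_shift[of "\<lambda>k. fps_nth F k * z ^ k" 2 "f z - z"] by (simp add: numeral_2_eq_2)
    thus ?thesis using hol unfolding class_A_def by blast
  qed
  moreover have "Re (1 + z * deriv (deriv f) z / deriv f z) < 1 + lam / 2" if z: "z \<in> unit_disc" for z
  proof -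
    have "1 - z ^ n \<noteq> 0" using slit[OF z] by auto
    hence "- of_real lam * z ^ n / (1 - z ^ n) = of_real lam - of_real lam * inverse (1 - z ^ n)"
      by (simp add: field_simps)
    \<comment> \<open>Inversion maps the disc of radius 1 about 1 onto the half-plane to the right of 1/2.\<close>
    moreover have "1 / 2 < Re (inverse (1 - z ^ n))"
    proof -
      have "norm (z ^ n) < 1" using z n by (simp add: norm_power power_less_one_iff)
      hence "(norm (z ^ n))\<^sup>2 < 1" by (simp add: power_less_one_iff)
      hence "(norm (1 - z ^ n))\<^sup>2 < 2 * Re (1 - z ^ n)"
        unfolding cmod_power2 by (simp add: power2_eq_square algebra_simps)
      moreover have "0 < (norm (1 - z ^ n))\<^sup>2" using \<open>1 - z ^ n \<noteq> 0\<close> by simp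
      ultimately have "1 / 2 < Re (1 - z ^ n) / (norm (1 - z ^ n))\<^sup>2"
        by (simp add: pos_less_divide_eq)
      thus ?thesis unfolding inverse_complex.sel(1) cmod_power2 .
    qed
    ultimately show ?thesis unfolding ratio[OF z]
      using mult_strict_left_mono[of "1 / 2" "Re (inverse (1 - z ^ n))" lam] lam
      by (simp del: inverse_complex.sel)
  qed
  moreover have "deriv f z \<noteq> 0" if "z \<in> unit_disc" for z using d1[OF that] by (simp add: h_def)
  ultimately have "f \<in> class_G lam" unfolding class_G_def by blast
  thus ?thesis using that ratio by blast
qed

text \<open>
Multiplied by \<open>1 - z\<^sup>n\<close>, the Riccati equation becomes \<open>H (1 - z\<^sup>n) = - \<lambda> z\<^sup>n (1 + g)\<close>.  Thus \<open>H\<close> starts with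
\<open>- \<lambda> z\<^sup>n\<close>, and as long as the earlier coefficients of \<open>g\<close> vanish, \<open>H\<^sub>k\<close> is just \<open>(k + 1) b\<^sub>k\<close>.
\<close>

lemma extremal_log_coeff:
  assumes lam: "0 < lam" "lam \<le> 1" and n: "n \<ge> 1"
  obtains f where "f \<in> class_G lam" "norm (log_coeff f n) = lam / (2 * real n * (real n + 1))"
proof -
  obtain f where f: "f \<in> class_G lam" and ratio: "\<And>z. z \<in> unit_disc \<Longrightarrow>
      z * deriv (deriv f) z / deriv f z = - of_real lam * z ^ n / (1 - z ^ n)"
    using extremal_in_class_G[OF lam(1) n] by blast
  obtain L where L: "is_log_branch f L" using log_branch_exists[OF lam f] .
  define A where "A = fps_expansion L 0"
  have A: "L has_fps_expansion A"
    using L unfolding A_def is_log_branch_def by (intro has_fps_expansion_fps_expansion[of unit_disc]) auto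
  define g where "g z = z * deriv L z" for z
  define G where "G = fps_X * fps_deriv A"
  have g: "g has_fps_expansion G"
    using log_derivative_expansion(1)[OF L A] unfolding g_def [abs_def] G_def .
  have G0: "fps_nth G 0 = 0" by (simp add: G_def)
  have f0: "f 0 = 0" using f by (rule class_G_zero)
  define H where "H = G + G * G + fps_X * fps_deriv G"
  have eq: "(g z + g z * g z + z * deriv g z) * (1 - z ^ n) = - of_real lam * z ^ n * (1 + g z)"
    if z: "z \<in> unit_disc" for z
  proof -
    have "deriv f z \<noteq> 0" using f z by (simp add: class_G_def)
    moreover have "norm (z ^ n) < 1" using z n by (simp add: norm_power power_less_one_iff)
    hence "1 - z ^ n \<noteq> 0" by auto
    ultimately show ?thesis
      using log_derivative_equation(2)[OF L f0 _ z, folded g_def] ratio[OF z] by simp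
  qed
  have "H * (1 - fps_X ^ n) = fps_const (- of_real lam) * fps_X ^ n * (1 + G)"
  proof (rule fps_expansion_unique_complex)
    show l: "(\<lambda>z. - of_real lam * z ^ n * (1 + g z)) has_fps_expansion
        fps_const (- of_real lam) * fps_X ^ n * (1 + G)"
      by (intro fps_expansion_intros g)
    have "eventually (\<lambda>z. (g z + g z * g z + z * deriv g z) * (1 - z ^ n)
        = - of_real lam * z ^ n * (1 + g z)) (nhds 0)"
      using eq by (intro eventually_nhds_in_open[of unit_disc 0, THEN eventually_mono]) auto
    moreover have "(\<lambda>z. (g z + g z * g z + z * deriv g z) * (1 - z ^ n)) has_fps_expansion H * (1 - fps_X ^ n)"
      unfolding H_def by (intro fps_expansion_intros g)
    ultimately show "(\<lambda>z. - of_real lam * z ^ n * (1 + g z)) has_fps_expansion H * (1 - fps_X ^ n)"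
      by (rule has_fps_expansion_cong[OF _ refl, THEN iffD1])
  qed
  hence Heq: "H = fps_X ^ n * (H + fps_const (- of_real lam) * (1 + G))"
    by (simp add: algebra_simps)
  have H: "fps_nth H k = of_nat (Suc k) * fps_nth G k + (\<Sum>i\<le>k. fps_nth G i * fps_nth G (k - i))" for k
    unfolding H_def by (rule riccati_coeff)
  have conv: "fps_nth H k = of_nat (Suc k) * fps_nth G k"
    if "\<And>i. i < k \<Longrightarrow> fps_nth G i = 0" for k
  proof -
    have "(\<Sum>i\<le>k. fps_nth G i * fps_nth G (k - i)) = 0"
    proof (intro sum.neutral ballI)
      fix i assume "i \<in> {..k}"
      thus "fps_nth G i * fps_nth G (k - i) = 0"
        using that[of i] G0 by (cases "i = k") auto
    qed
    thus ?thesis by (simp add: H)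
  qed
  have low: "fps_nth G k = 0" if "k < n" for k
    using that
  proof (induction k rule: less_induct)
    case (less k)
    have "fps_nth H k = 0" by (subst Heq) (simp add: fps_X_power_mult_nth less.prems)
    moreover have "fps_nth H k = of_nat (Suc k) * fps_nth G k" using less by (intro conv) auto
    ultimately show ?case by (simp del: of_nat_Suc)
  qed
  have "fps_nth H n = - of_real lam"
    using n by (subst Heq) (simp add: fps_X_power_mult_nth G0 conv)
  hence "of_nat (Suc n) * fps_nth G n = - of_real lam" using conv[of n] low by simp
  hence "norm (of_nat (Suc n) * fps_nth G n) = norm (- complex_of_real lam)" by simp
  hence "real (Suc n) * norm (fps_nth G n) = lam" using lam by (simp add: norm_mult del: of_nat_Suc)
  hence "norm (fps_nth G n) = lam / (real n + 1)" by (simp add: field_simps)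
  hence "norm (log_coeff f n) = lam / (2 * real n * (real n + 1))"
    using log_derivative_expansion(2)[OF L A, of n] by (simp add: G_def [symmetric] mult_ac)
  thus ?thesis using that f by blast
qed

section \<open>Sharp bound for the logarithmic coefficients\<close>

theorem theorem4p3:
  fixes lam :: real
  assumes "0 < lam" and "lam \<le> 1"
  shows "(\<forall>f\<in>class_G lam. \<forall>n\<ge>1. norm (log_coeff f n) \<le> lam / (2 * real n * (real n + 1))) \<and>
    (\<forall>n\<ge>1. \<forall>c::real. c < lam / (2 * real n * (real n + 1)) \<longrightarrow>
      \<not> (\<forall>f\<in>class_G lam. norm (log_coeff f n) \<le> c))"
proof (intro conjI ballI allI impI)
  fix f and n :: nat assume f: "f \<in> class_G lam" and n: "n \<ge> 1"
  obtain L where L: "is_log_branch f L" using log_branch_exists[OF assms f] .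
  define A where "A = fps_expansion L 0"
  have A: "L has_fps_expansion A"
    using L unfolding A_def is_log_branch_def by (intro has_fps_expansion_fps_expansion[of unit_disc]) auto
  note G = log_derivative_expansion[OF L A]
  have "real (Suc n) * norm (fps_nth (fps_X * fps_deriv A) n) \<le> lam"
    by (rule class_G_log_derivative_coeff_bound[OF assms f L G(1) n])
  hence "norm (fps_nth (fps_X * fps_deriv A) n) \<le> lam / (real n + 1)"
    by (simp add: pos_le_divide_eq mult.commute add.commute)
  hence "norm (fps_nth (fps_X * fps_deriv A) n) / (2 * real n) \<le> lam / (real n + 1) / (2 * real n)"
    by (intro divide_right_mono) auto
  thus "norm (log_coeff f n) \<le> lam / (2 * real n * (real n + 1))"
    unfolding G(2) by (simp add: mult_ac)
next
  fix n :: nat and c :: real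
  assume "n \<ge> 1" "c < lam / (2 * real n * (real n + 1))"
  thus "\<not> (\<forall>f\<in>class_G lam. norm (log_coeff f n) \<le> c)"
    using extremal_log_coeff[OF assms, of n] by (metis linorder_not_le)
qed

end
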